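(* Let predictions and target $y$ lie on $S^{d-1}$, with score $\cos(\hat u,y)$ for a prediction $\hat u$. There exist a finite orbit and predictions $\{u_k\}$ for which the normalized mean $\bar u=\sum_k u_k\big/\big\|\sum_k u_k\big\|$ scores strictly below every $u_k$ (that is, $\cos(\bar u,y)<\cos(u_k,y)$ for every $k$), and others for which $\sum_k u_k=0$ and $\bar u$ is undefined.
   Context: $S^{d-1}\subset\mathbb R^d$ is the Euclidean unit sphere, $\|\cdot\|$ is the Euclidean norm, and for unit vectors $\cos(\hat u,y)=\langle\hat u,y\rangle$ is the Euclidean inner product. The index $k$ runs over the elements of a finite orbit of equivalent presentations of one input, and $u_k\in S^{d-1}$ is the output of a direction-valued predictor on the $k$-th presentation; a higher score is better.
   Formalization: The first claim (normalized mean scoring strictly below every prediction) is stated only for d ≥ 2, since on S^0 = {1, -1} a nonzero sum normalizes to one of the u_k and the claim fails; the second claim is for all d ≥ 1. *)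

theory Defs
  imports "HOL-Analysis.Analysis" "HOL-Algebra.Group_Action"
begin

(* Only used for unit vectors, where the inner product is the cosine of the angle. *)
definition cos_score :: "'v::real_inner \<Rightarrow> 'v \<Rightarrow> real" where
  "cos_score u y = u \<bullet> y"

(* None stands for "undefined": division by zero would otherwise return the zero vector. *)
definition normalized_mean :: "('k \<Rightarrow> 'v::real_normed_vector) \<Rightarrow> 'k set \<Rightarrow> 'v option" where
  "normalized_mean u K =
     (let s = (\<Sum>k\<in>K. u k) in if s = 0 then None else Some (s /\<^sub>R norm s))"

end

theory Submission
  imports Defs
begin

text \<open>
  The normalized mean of two unit vectors points along their bisector, so it is pushed further
  away from \<open>y\<close> than both when they lie symmetrically about \<open>-y\<close>; two antipodal vectors have
  no mean direction at all. Both patterns live on the two-point orbit of the group of order two.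
\<close>

definition parity_group :: "nat monoid" where
  "parity_group = \<lparr>carrier = {0, 1}, monoid.mult = (\<lambda>a b. (a + b) mod 2), one = 0\<rparr>"

text \<open>The restriction to \<open>{0, 1}\<close> makes each map extensional, as membership in
  \<open>Bij {0, 1}\<close> requires.\<close>

definition parity_action :: "nat \<Rightarrow> nat \<Rightarrow> nat" where
  "parity_action g = (\<lambda>x\<in>{0, 1}. (g + x) mod 2)"

lemma group_parity_group: "group parity_group"
  by (rule groupI) (auto simp: parity_group_def)

lemma parity_action_Bij:
  assumes "g \<in> {0, 1}"
  shows "parity_action g \<in> Bij {0, 1}"
  using assms by (auto simp: Bij_def parity_action_def bij_betw_def inj_on_def)

lemma group_action_parity: "group_action parity_group {0, 1} parity_action"
proof -
  have "parity_action ((g + h) mod 2) = compose {0, 1} (parity_action g) (parity_action h)"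
    if "g \<in> {0, 1}" "h \<in> {0, 1}" for g h
    using that by (auto simp: parity_action_def compose_def fun_eq_iff)
  then have "parity_action \<in> hom parity_group (BijGroup {0, 1})"
    using parity_action_Bij by (intro homI) (simp_all add: BijGroup_def parity_group_def)
  then show ?thesis
    by (simp add: group_action_def group_hom_def group_hom_axioms_def
        group_parity_group group_BijGroup)
qed

text \<open>The action is transitive, so \<open>{0, 1}\<close> can serve both as the set acted on
  and as the orbit.\<close>

lemma orbit_parity: "orbit parity_group parity_action 0 = {0, 1}"
proof -
  have "orbit parity_group parity_action 0 = (\<lambda>g. parity_action g 0) ` {0, 1}"
    by (auto simp: orbit_def parity_group_def)
  then show ?thesis
    by (simp add: parity_action_def)
qed

text \<open>The \<open>w\<close> components cancel in the sum, which leaves a negative multiple of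
  \<open>y\<close>. Its direction \<open>- y\<close> has score -1, while both vectors score
  -3/5.\<close>

lemma normalized_mean_scores_below:
  fixes y w :: "'v::real_inner"
  assumes "norm y = 1" "norm w = 1" "y \<bullet> w = 0"
  obtains u :: "nat \<Rightarrow> 'v"
  where "\<And>k. norm (u k) = 1"
    and "normalized_mean u {0, 1} = Some (- y)"
    and "\<And>k. cos_score (- y) y < cos_score (u k) y"
proof
  \<comment> \<open>The triple 3, 4, 5 gives unit vectors with rational coefficients. Every nonzero
    \<open>k\<close> gets the same vector, so norm and score can be stated for all
    \<open>k\<close>.\<close>
  define u where "u k = - (3/5) *\<^sub>R y + (if k = 0 then 4/5 else - (4/5)) *\<^sub>R w" for k :: nat
  have inner: "y \<bullet> y = 1" "w \<bullet> w = 1" "w \<bullet> y = 0"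
    using assms by (simp_all add: norm_eq_1 inner_commute)
  \<comment> \<open>This makes the sum nonzero, which selects the \<open>Some\<close> branch of
    \<open>normalized_mean\<close>.\<close>
  have "y \<noteq> 0"
    using assms(1) by auto
  show "norm (u k) = 1" for k
    using inner assms(3) by (simp add: norm_eq_1 u_def inner_simps)
  \<comment> \<open>The coefficient stays an unevaluated difference so that it splits into the
    \<open>y\<close> parts of \<open>u 0\<close> and \<open>u 1\<close>.\<close>
  have "(\<Sum>k\<in>{0, 1}. u k) = (- (3/5) - 3/5) *\<^sub>R y"
    by (simp only: scaleR_left.diff) (simp add: u_def)
  then show "normalized_mean u {0, 1} = Some (- y)"
    using assms(1) \<open>y \<noteq> 0\<close> by (simp add: normalized_mean_def Let_def)
  show "cos_score (- y) y < cos_score (u k) y" for k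
    using inner by (simp add: cos_score_def u_def inner_simps)
qed

text \<open>The first claim needs dimension at least 2: on the sphere \<open>{y, - y}\<close> of
  dimension one, a mean equal to \<open>- y\<close> forces some prediction to be \<open>- y\<close>
  as well, and a mean equal to \<open>y\<close> has the top score.\<close>

theorem proposition3:
  fixes y :: "real ^ 'd"
  assumes "y \<in> sphere 0 1"
  shows "\<exists>(G :: nat monoid) (E :: nat set) \<phi> x K.
    group_action G E \<phi> \<and> x \<in> E \<and> K = orbit G \<phi> x \<and> finite K \<and>
    (CARD('d) \<ge> 2 \<longrightarrow>
      (\<exists>u. u \<in> E \<rightarrow> sphere 0 1 \<and>
        (\<exists>m. normalized_mean u K = Some m \<and>
          (\<forall>k\<in>K. cos_score m y < cos_score (u k) y)))) \<and>
    (\<exists>u. u \<in> E \<rightarrow> (sphere 0 1 :: (real ^ 'd) set) \<and>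
      (\<Sum>k\<in>K. u k) = 0 \<and> normalized_mean u K = None)"
proof -
  have y: "norm y = 1"
    using assms by simp
  have below: "\<exists>u. u \<in> {0, 1::nat} \<rightarrow> sphere 0 1 \<and>
      (\<exists>m. normalized_mean u {0, 1} = Some m \<and>
        (\<forall>k\<in>{0, 1}. cos_score m y < cos_score (u k) y))"
    if "CARD('d) \<ge> 2"
  proof -
    have "2 \<le> DIM(real ^ 'd)"
      using that by simp
    \<comment> \<open>Here the dimension bound enters: it provides a direction orthogonal to
      \<open>y\<close>.\<close>
    then obtain v where v: "v \<noteq> 0" "orthogonal y v"
      using orthogonal_to_vector_exists[of y] by blast
    define w where "w = v /\<^sub>R norm v"
    have "norm w = 1" "y \<bullet> w = 0"
      using v by (simp_all add: w_def orthogonal_def)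
    from normalized_mean_scores_below[OF y this] obtain u :: "nat \<Rightarrow> real ^ 'd"
      where "\<And>k. norm (u k) = 1" "normalized_mean u {0, 1} = Some (- y)"
        "\<And>k. cos_score (- y) y < cos_score (u k) y"
      by blast
    then show ?thesis
      by (intro exI[of _ u]) auto
  qed
  have undefined_mean: "\<exists>u. u \<in> {0, 1::nat} \<rightarrow> (sphere 0 1 :: (real ^ 'd) set) \<and>
      (\<Sum>k\<in>{0, 1}. u k) = 0 \<and> normalized_mean u {0, 1} = None"
    \<comment> \<open>The antipodal pair is built from \<open>y\<close> alone, so it exists in
      dimension one too.\<close>
    using y by (intro exI[of _ "\<lambda>k. if k = 0 then y else - y"])
      (auto simp: normalized_mean_def)
  show ?thesis
    by (rule exI[of _ parity_group], rule exI[of _ "{0, 1}"], rule exI[of _ parity_action],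
        rule exI[of _ 0], rule exI[of _ "{0, 1}"])
      (use group_action_parity orbit_parity below undefined_mean in simp)
qed

end
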